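(* Consider the Newtonian 4-body problem in $\mathbb{R}^3$ with arbitrary masses $m_1,m_2,m_3,m_4>0$. Let $q=(q_1,q_2,q_3,q_4): I\to(\mathbb{R}^3)^4$ be a solution of Newton's equations with zero angular momentum, defined on an interval $I\subset\mathbb{R}$ of infinite length, and suppose the solution is bounded. Then there are infinitely many times $t\in I$ at which the four points $q_1(t),q_2(t),q_3(t),q_4(t)$ all lie in a common affine plane of $\mathbb{R}^3$.
   Context: Let $G>0$ be the gravitational constant and $r_{ab}=|q_a-q_b|$ the Euclidean interparticle distances. Newton's equations are $m_a\ddot q_a=-\partial V/\partial q_a$, $a=1,\dots,4$, with $V(q)=-G\sum_{a<b} m_a m_b/r_{ab}$. A solution on an interval $I$ is a curve satisfying these equations and having all $r_{ab}(t)>0$ for $t\in I$. A solution is called bounded if there is a constant $c$ with $r_{ab}(t)\le c$ for all pairs $a\neq b$ and all $t\in I$. Angular momentum is taken in the center-of-mass frame: with $M=\sum_a m_a$ and $q_{cm}=\frac1M\sum_a m_a q_a$, zero angular momentum means $\sum_a m_a (q_a-q_{cm})\wedge(\dot q_a-\dot q_{cm})=0$ (a conserved quantity). *)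

theory Defs
  imports "HOL-Analysis.Analysis"
begin

text \<open>
  A configuration of four points in three-space is a vector of type \<open>real^3^4\<close>; \<open>x $ a\<close> is
  the position of body \<open>a\<close>. The bodies are indexed by the numeral type \<open>4\<close>, whose elements
  are 0, 1, 2, 3, with its linear order.
\<close>

definition potential :: "real \<Rightarrow> (4 \<Rightarrow> real) \<Rightarrow> real^3^4 \<Rightarrow> real" where
  "potential G m x =
     - G * (\<Sum>(a, b) \<in> {(a, b). a < b}. m a * m b / dist (x $ a) (x $ b))"

text \<open>The gradient at \<open>x\<close> of \<open>f\<close> as a function of the position of body \<open>a\<close> alone, the other
  positions being held fixed.\<close>

definition has_partial_gradient ::
  "(real^3^4 \<Rightarrow> real) \<Rightarrow> 4 \<Rightarrow> real^3^4 \<Rightarrow> real^3 \<Rightarrow> bool" where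
  "has_partial_gradient f a x g \<longleftrightarrow>
     (GDERIV (\<lambda>y. f (\<chi> b. if b = a then y else x $ b)) (x $ a) :> g)"

text \<open>The curve \<open>q\<close> with velocity \<open>v\<close> solves Newton's equations on \<open>I\<close> without collisions.
  Derivatives are relative to \<open>I\<close>, hence one-sided at an endpoint belonging to \<open>I\<close>; on a
  nondegenerate interval \<open>v\<close> is determined by \<open>q\<close>.\<close>

definition newton_solution ::
  "real \<Rightarrow> (4 \<Rightarrow> real) \<Rightarrow> real set \<Rightarrow> (real \<Rightarrow> real^3^4) \<Rightarrow> (real \<Rightarrow> real^3^4) \<Rightarrow> bool" where
  "newton_solution G m I q v \<longleftrightarrow>
     (\<forall>t\<in>I.
        (\<forall>a b. a \<noteq> b \<longrightarrow> dist (q t $ a) (q t $ b) > 0) \<and>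
        (q has_vector_derivative v t) (at t within I) \<and>
        (\<exists>w. (v has_vector_derivative w) (at t within I) \<and>
             (\<forall>a. \<exists>g. has_partial_gradient (potential G m) a (q t) g \<and>
                      m a *\<^sub>R w $ a = - g)))"

definition bounded_solution :: "real set \<Rightarrow> (real \<Rightarrow> real^3^4) \<Rightarrow> bool" where
  "bounded_solution I q \<longleftrightarrow>
     (\<exists>c. \<forall>t\<in>I. \<forall>a b. a \<noteq> b \<longrightarrow> dist (q t $ a) (q t $ b) \<le> c)"

definition center_of_mass :: "(4 \<Rightarrow> real) \<Rightarrow> real^3^4 \<Rightarrow> real^3" where
  "center_of_mass m x = (1 / (\<Sum>a\<in>UNIV. m a)) *\<^sub>R (\<Sum>a\<in>UNIV. m a *\<^sub>R x $ a)"

text \<open>The exterior product of two vectors, as a skew-symmetric matrix.\<close>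

definition wedge :: "real^3 \<Rightarrow> real^3 \<Rightarrow> real^3^3" where
  "wedge x y = (\<chi> i j. x $ i * y $ j - x $ j * y $ i)"

text \<open>Angular momentum in the center-of-mass frame for positions \<open>x\<close> and velocities \<open>v\<close>.
  As the center of mass is linear in the positions, its velocity is \<open>center_of_mass m v\<close>.\<close>

definition angular_momentum :: "(4 \<Rightarrow> real) \<Rightarrow> real^3^4 \<Rightarrow> real^3^4 \<Rightarrow> real^3^3" where
  "angular_momentum m x v =
     (\<Sum>a\<in>UNIV. m a *\<^sub>R wedge (x $ a - center_of_mass m x) (v $ a - center_of_mass m v))"

end

theory Submission
  imports Defs
begin

text \<open>
  Let \<open>Q\<^sub>a\<close> and \<open>V\<^sub>a\<close> be positions and velocities in the center-of-mass frame, and for a vector \<open>n\<close>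
  let \<open>\<Theta>(t, n) = \<Sum>\<^sub>a m\<^sub>a (n \<bullet> Q\<^sub>a)\<^sup>2\<close>. The minimum of \<open>\<Theta>(t, _)\<close> over unit vectors is \<open>S(t)\<^sup>2\<close>, where
  \<open>S \<ge> 0\<close> is the mass-weighted distance of the configuration from the coplanar ones. While the
  four points are not coplanar, \<open>S\<close> is positive and behaves like an oscillator pulled towards 0: it
  satisfies \<open>S'' \<le> - \<kappa> S\<close> with \<open>\<kappa> = G M / r\<^sup>3\<close>, where \<open>M\<close> is the total mass and \<open>r\<close> bounds the
  mutual distances. By Sturm comparison \<open>S\<close> cannot stay positive on an interval of length
  \<open>pi / \<omega>\<close> if \<open>\<omega>\<^sup>2 < \<kappa>\<close>, so each such interval contains a coplanar time, and an infinitely long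
  interval contains infinitely many.

  The function \<open>S\<close> need not be differentiable where the smallest eigenvalue of \<open>\<Theta>\<close> is multiple, so
  the differential inequality is used only through functions touching \<open>S\<close> from above. Let a multiple
  of \<open>\<psi>(t) = sin (\<omega> (t - s))\<close> touch \<open>S\<close> from below at a time \<open>t\<^sub>0\<close> where the unit vector \<open>n\<^sub>0\<close>
  minimizes \<open>\<Theta>\<close>. Any curve \<open>n(t)\<close> through \<open>n\<^sub>0\<close> gives the upper bound
  \<open>\<Theta>(t, n(t)) / |n(t)|\<^sup>2\<close> for \<open>S\<^sup>2\<close>; the right choice is \<open>n(t) = n\<^sub>0 - (t - t\<^sub>0) b\<close>, where \<open>b\<close>
  solves \<open>b \<bullet> Q\<^sub>a = n\<^sub>0 \<bullet> V\<^sub>a\<close> for all \<open>a\<close>. Such a \<open>b\<close> exists because four points that are not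
  coplanar are affinely independent, and it makes every \<open>n(t) \<bullet> Q\<^sub>a(t)\<close> stationary at \<open>t\<^sub>0\<close>. In the
  second derivative of \<open>\<Theta>(t, n(t))\<close> at \<open>t\<^sub>0\<close> two terms remain. The velocity term is
  \<open>- 4 \<Sum>\<^sub>a m\<^sub>a (n\<^sub>0 \<bullet> Q\<^sub>a) (b \<bullet> V\<^sub>a)\<close>; vanishing angular momentum lets \<open>n\<^sub>0\<close> and \<open>b\<close> be interchanged
  in it, which turns it into \<open>- 4 \<Theta>(t\<^sub>0, b)\<close>, so it has the good sign and outweighs the
  effect of dividing by \<open>|n(t)|\<^sup>2\<close>. The force term is at most
  \<open>- 2 \<kappa> \<Theta>(t\<^sub>0, n\<^sub>0)\<close>, because gravity pulls each pair of bodies together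
  (\<open>gravity_restores_to_plane\<close>). Together they contradict the second-order condition at
  the touching point (\<open>no_support_of_planar_inertia\<close>).
\<close>

section \<open>Four points in space\<close>

lemma coplanar_if_subset_hyperplane:
  fixes z :: "real^3"
  assumes "z \<noteq> 0" "\<And>x. x \<in> S \<Longrightarrow> z \<bullet> x = s"
  shows "coplanar S"
proof -
  have "S \<subseteq> {x. z \<bullet> x = s}"
    using assms(2) by auto
  then have "aff_dim S \<le> aff_dim {x. z \<bullet> x = s}"
    by (rule aff_dim_subset)
  then have dim: "aff_dim S \<le> 2"
    using assms(1) by simp
  obtain B where B: "\<not> affine_dependent B" "affine hull B = affine hull S"
    using affine_basis_exists by metis
  have "aff_dim B = int (card B) - 1"
    using B(1) by (simp add: aff_dim_affine_independent)
  moreover have "aff_dim B = aff_dim S"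
    using B(2) by (metis aff_dim_affine_hull)
  ultimately have "card B \<le> 3"
    using dim by linarith
  moreover have "finite B"
    using B(1) aff_independent_finite by blast
  ultimately have "coplanar B"
    by (rule coplanar_small[rotated])
  then show ?thesis
    using B(2) by (metis coplanar_affine_hull_coplanar)
qed

text \<open>The map sending an affine function on space to its values at the four points is linear between
  spaces of dimension 4, and it is injective because an affine function other than 0 vanishes at
  most on a plane. This is where the number of bodies matters.\<close>

lemma affine_interpolation:
  fixes x :: "real^3^4" and c :: "4 \<Rightarrow> real"
  assumes "\<not> coplanar (range (\<lambda>a. x $ a))"
  obtains z s where "\<And>a. z \<bullet> x $ a + s = c a"
proof -
  define L :: "(real^3) \<times> real \<Rightarrow> real^4" where "L = (\<lambda>(z, s). \<chi> a. z \<bullet> x $ a + s)"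
  have lin: "linear L"
    by (rule linearI) (auto simp: L_def vec_eq_iff inner_add_left algebra_simps)
  have "p = 0" if "L p = 0" for p
  proof -
    obtain z s where p: "p = (z, s)" by (cases p)
    have zero: "z \<bullet> x $ a + s = 0" for a
      using that by (auto simp: L_def p vec_eq_iff)
    have "z = 0"
    proof (rule ccontr)
      assume "z \<noteq> 0"
      then have "coplanar (range (\<lambda>a. x $ a))"
        by (rule coplanar_if_subset_hyperplane[where s = "- s"]) (use zero in \<open>auto simp: eq_neg_iff_add_eq_0\<close>)
      with assms show False ..
    qed
    with zero show ?thesis by (simp add: p zero_prod_def)
  qed
  then have "inj L"
    using linear_injective_0[OF lin] by blast
  then have "surj L"
    using lin by (intro linear_injective_imp_surjective) simp_all
  then obtain p where "L p = (\<chi> a. c a)"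
    by (metis surjD)
  then have "fst p \<bullet> x $ a + snd p = c a" for a
    by (auto simp: L_def vec_eq_iff split: prod.splits)
  then show ?thesis by (rule that)
qed

section \<open>The second-order condition at a minimum\<close>

lemma second_derivative_nonneg_at_local_min:
  fixes h h' :: "real \<Rightarrow> real"
  assumes "\<delta> > 0"
    and h: "\<And>t. \<bar>t - t0\<bar> < \<delta> \<Longrightarrow> (h has_real_derivative h' t) (at t)"
    and h': "(h' has_real_derivative h2) (at t0)"
    and min: "\<And>t. \<bar>t - t0\<bar> < \<delta> \<Longrightarrow> h t0 \<le> h t"
  shows "h' t0 = 0" and "0 \<le> h2"
proof -
  show zero: "h' t0 = 0"
    using h[of t0] min \<open>\<delta> > 0\<close> by (intro DERIV_local_min[of h _ t0 \<delta>]) (auto simp: abs_minus_commute)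
  show "0 \<le> h2"
  proof (rule ccontr)
    assume "\<not> 0 \<le> h2"
    then obtain d where d: "d > 0" "\<And>u. 0 < u \<Longrightarrow> u < d \<Longrightarrow> h' (t0 + u) < h' t0"
      using DERIV_neg_dec_right[OF h'] by force
    define e where "e = min d \<delta> / 2"
    have e: "0 < e" "e < d" "e < \<delta>"
      using d(1) \<open>\<delta> > 0\<close> by (auto simp: e_def min_def)
    have "h t0 > h (t0 + e)"
    proof (rule DERIV_neg_imp_decreasing_open[where f = h])
      show "t0 < t0 + e" using e by simp
      show "\<exists>y. (h has_real_derivative y) (at t) \<and> y < 0" if "t0 < t" "t < t0 + e" for t
        using h[of t] d(2)[of "t - t0"] zero that e by auto
      show "continuous_on {t0..t0 + e} h"
        by (rule DERIV_atLeastAtMost_imp_continuous_on) (use h e in force)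
    qed
    with min[of "t0 + e"] e show False by simp
  qed
qed

section \<open>The gravitational force\<close>

text \<open>The factor \<open>of_bool (c = a) - of_bool (d = a)\<close> is the sign with which the position of body \<open>a\<close>
  enters \<open>x $ c - x $ d\<close>. Keeping it inside the sum over pairs avoids splitting that sum according
  to the position of \<open>a\<close> in the order of the bodies.\<close>

lemma potential_partial_gradient:
  assumes grad: "has_partial_gradient (potential G m) a x g"
    and distinct: "\<And>c d. c \<noteq> d \<Longrightarrow> x $ c \<noteq> x $ d"
  shows "h \<bullet> g = G * (\<Sum>(c, d) \<in> {(c, d). c < d}. m c * m d *
           ((of_bool (c = a) - of_bool (d = a)) * (h \<bullet> (x $ c - x $ d))) / dist (x $ c) (x $ d) ^ 3)"
proof -
  define X where "X = (\<lambda>y. \<chi> b. if b = a then y else x $ b)"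
  have X: "((\<lambda>y. X y $ c) has_derivative (\<lambda>h. of_bool (c = a) *\<^sub>R h)) (at (x $ a))" for c
    by (cases "c = a") (auto simp: X_def)
  have X0: "X (x $ a) $ c = x $ c" for c
    by (simp add: X_def)
  have pair: "((\<lambda>y. m c * m d / dist (X y $ c) (X y $ d)) has_derivative
      (\<lambda>h. - (m c * m d * ((of_bool (c = a) - of_bool (d = a)) * (h \<bullet> (x $ c - x $ d))) / dist (x $ c) (x $ d) ^ 3)))
      (at (x $ a))" if "c \<noteq> d" for c d
  proof -
    have ne: "x $ c - x $ d \<noteq> 0" using distinct that by simp
    have diff: "((\<lambda>y. X y $ c - X y $ d) has_derivative
        (\<lambda>h. (of_bool (c = a) - of_bool (d = a)) *\<^sub>R h)) (at (x $ a))"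
      using has_derivative_diff[OF X[of c] X[of d]] by (simp add: scaleR_left_diff_distrib)
    have nrm: "((\<lambda>y. norm (X y $ c - X y $ d)) has_derivative
        (\<lambda>h. (of_bool (c = a) - of_bool (d = a)) *\<^sub>R h \<bullet> sgn (x $ c - x $ d))) (at (x $ a))"
      using has_derivative_compose[OF diff, of norm "\<lambda>h. h \<bullet> sgn (x $ c - x $ d)"] has_derivative_norm[OF ne]
      by (simp add: X0)
    show ?thesis
      unfolding dist_norm
      by (rule has_derivative_eq_rhs[OF has_derivative_divide[OF has_derivative_const nrm]])
         (use ne in \<open>simp_all add: X0 fun_eq_iff sgn_div_norm divide_simps power3_eq_cube\<close>)
  qed
  have "((\<lambda>y. potential G m (X y)) has_derivative
      (\<lambda>h. - G * (\<Sum>(c, d) \<in> {(c, d). c < d}.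
        - (m c * m d * ((of_bool (c = a) - of_bool (d = a)) * (h \<bullet> (x $ c - x $ d))) / dist (x $ c) (x $ d) ^ 3))))
      (at (x $ a))"
    unfolding potential_def case_prod_beta
    by (intro has_derivative_mult_right has_derivative_sum) (use pair in force)
  moreover have "((\<lambda>y. potential G m (X y)) has_derivative (\<lambda>h. h \<bullet> g)) (at (x $ a))"
    using grad by (simp add: has_partial_gradient_def gderiv_def X_def)
  ultimately have "(\<lambda>h. h \<bullet> g) = (\<lambda>h. - G * (\<Sum>(c, d) \<in> {(c, d). c < d}.
        - (m c * m d * ((of_bool (c = a) - of_bool (d = a)) * (h \<bullet> (x $ c - x $ d))) / dist (x $ c) (x $ d) ^ 3)))"
    by (rule has_derivative_unique[rotated])
  from fun_cong[OF this, of h] show ?thesis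
    by (simp add: case_prod_beta sum_negf)
qed

text \<open>The work of the forces under the virtual displacement that moves each body \<open>a\<close> by \<open>f a\<close> along \<open>n\<close>.
  Forces come in opposite pairs, so only the differences \<open>f c - f d\<close> enter.\<close>

lemma newton_virtual_work:
  assumes distinct: "\<And>c d. c \<noteq> d \<Longrightarrow> x $ c \<noteq> x $ d"
    and newton: "\<And>a. \<exists>g. has_partial_gradient (potential G m) a x g \<and> m a *\<^sub>R w $ a = - g"
  shows "(\<Sum>a\<in>UNIV. m a * (f a * (n \<bullet> w $ a))) =
    - G * (\<Sum>(c, d) \<in> {(c, d). c < d}. m c * m d * ((f c - f d) * (n \<bullet> (x $ c - x $ d))) / dist (x $ c) (x $ d) ^ 3)"
proof -
  let ?P = "{(c, d). c < (d::4)}"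
  let ?k = "\<lambda>c d. m c * m d * (n \<bullet> (x $ c - x $ d)) / dist (x $ c) (x $ d) ^ 3"
  have acc: "m a * (n \<bullet> w $ a) = - G * (\<Sum>(c, d) \<in> ?P. (of_bool (c = a) - of_bool (d = a)) * ?k c d)" for a
  proof -
    obtain g where g: "has_partial_gradient (potential G m) a x g" "m a *\<^sub>R w $ a = - g"
      using newton by blast
    have "m a * (n \<bullet> w $ a) = - (n \<bullet> g)"
      using arg_cong[OF g(2), of "inner n"] by simp
    then show ?thesis
      using potential_partial_gradient[OF g(1) distinct] by (simp add: mult_ac)
  qed
  have "(\<Sum>a\<in>UNIV. m a * (f a * (n \<bullet> w $ a))) = (\<Sum>a\<in>UNIV. f a * (m a * (n \<bullet> w $ a)))"
    by (simp add: mult_ac)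
  also have "\<dots> = - G * (\<Sum>a\<in>UNIV. \<Sum>(c, d) \<in> ?P. f a * ((of_bool (c = a) - of_bool (d = a)) * ?k c d))"
    unfolding acc by (simp add: sum_distrib_left case_prod_beta mult_ac sum_negf)
  also have "\<dots> = - G * (\<Sum>(c, d) \<in> ?P. \<Sum>a\<in>UNIV. f a * ((of_bool (c = a) - of_bool (d = a)) * ?k c d))"
    by (subst sum.swap) (simp add: case_prod_beta)
  also have "(\<lambda>(c, d). \<Sum>a\<in>UNIV. f a * ((of_bool (c = a) - of_bool (d = a)) * ?k c d)) =
      (\<lambda>(c, d). m c * m d * ((f c - f d) * (n \<bullet> (x $ c - x $ d))) / dist (x $ c) (x $ d) ^ 3)"
  proof (intro ext, clarify)
    fix c d
    have "(\<Sum>a\<in>UNIV. f a * ((of_bool (c = a) - of_bool (d = a)) * ?k c d)) =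
        (\<Sum>a\<in>UNIV. if c = a then f a * ?k c d else 0) - (\<Sum>a\<in>UNIV. if d = a then f a * ?k c d else 0)"
      unfolding sum_subtractf[symmetric] by (rule sum.cong) auto
    also have "\<dots> = (f c - f d) * ?k c d"
      by (simp add: left_diff_distrib diff_divide_distrib)
    finally show "(\<Sum>a\<in>UNIV. f a * ((of_bool (c = a) - of_bool (d = a)) * ?k c d)) =
      m c * m d * ((f c - f d) * (n \<bullet> (x $ c - x $ d))) / dist (x $ c) (x $ d) ^ 3"
      by (simp add: mult_ac)
  qed
  finally show ?thesis .
qed

text \<open>Lagrange's identity: the variance of \<open>f\<close>, here of mean zero, as a sum over pairs.\<close>

lemma sum_pairs_weighted_square_diff:
  fixes m f :: "'n::{finite,linorder} \<Rightarrow> real"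
  assumes "(\<Sum>a\<in>UNIV. m a * f a) = 0"
  shows "(\<Sum>(c, d) \<in> {(c, d). c < d}. m c * m d * (f c - f d)\<^sup>2) = sum m UNIV * (\<Sum>a\<in>UNIV. m a * (f a)\<^sup>2)"
proof -
  let ?F = "\<lambda>(c, d). m c * m d * (f c - f d)\<^sup>2"
  let ?P = "{(c, d). c < (d::'n)}" and ?Q = "{(c, d). d < (c::'n)}" and ?D = "{(c, d). c = (d::'n)}"
  have "sum ?F UNIV = sum ?F ((?P \<union> ?Q) \<union> ?D)"
    by (rule arg_cong[of _ _ "sum ?F"]) auto
  also have "\<dots> = sum ?F (?P \<union> ?Q) + sum ?F ?D"
    by (rule sum.union_disjoint) auto
  also have "sum ?F ?D = 0"
    by (rule sum.neutral) auto
  also have "sum ?F (?P \<union> ?Q) = sum ?F ?P + sum ?F ?Q"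
    by (rule sum.union_disjoint) auto
  also have "sum ?F ?Q = sum ?F ?P"
    by (rule sum.reindex_bij_witness[where i = prod.swap and j = prod.swap])
       (auto simp: power2_commute mult_ac)
  finally have half: "sum ?F UNIV = 2 * sum ?F ?P" by simp
  have "sum ?F UNIV = (\<Sum>c\<in>UNIV. \<Sum>d\<in>UNIV. m c * m d * (f c - f d)\<^sup>2)"
    by (simp add: sum.cartesian_product)
  also have "\<dots> = (\<Sum>c\<in>UNIV. \<Sum>d\<in>UNIV. (m c * (f c)\<^sup>2) * m d + m c * (m d * (f d)\<^sup>2)
        - 2 * ((m c * f c) * (m d * f d)))"
    by (intro sum.cong refl) (simp add: power2_eq_square algebra_simps)
  also have "\<dots> = 2 * (sum m UNIV * (\<Sum>a\<in>UNIV. m a * (f a)\<^sup>2)) - 2 * (\<Sum>a\<in>UNIV. m a * f a)\<^sup>2"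
    by (simp add: sum.distrib sum_subtractf sum_distrib_left[symmetric] sum_distrib_right[symmetric] power2_eq_square)
  finally show ?thesis using half assms by simp
qed

section \<open>The center-of-mass frame\<close>

text \<open>For a unit vector \<open>n\<close> this is the moment of inertia with respect to the plane through the origin
  orthogonal to \<open>n\<close>. It is homogeneous of degree 2 in \<open>n\<close>, so that \<open>n\<close> need not be normalized along
  a curve of normal vectors.\<close>

definition planar_inertia :: "('n::finite \<Rightarrow> real) \<Rightarrow> 'a::real_inner ^ 'n \<Rightarrow> 'a \<Rightarrow> real" where
  "planar_inertia m x n = (\<Sum>a\<in>UNIV. m a * (n \<bullet> x $ a)\<^sup>2)"

definition centered :: "(4 \<Rightarrow> real) \<Rightarrow> real^3^4 \<Rightarrow> real^3^4" where
  "centered m x = (\<chi> a. x $ a - center_of_mass m x)"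

lemma centered_nth [simp]: "centered m x $ a = x $ a - center_of_mass m x"
  by (simp add: centered_def)

lemma bounded_linear_centered: "bounded_linear (centered m)"
proof -
  have "linear (centered m)"
    by (rule linearI)
       (simp_all add: vec_eq_iff center_of_mass_def scaleR_add_right sum.distrib scaleR_right_diff_distrib
          scaleR_sum_right mult_ac)
  then show ?thesis by (simp add: linear_conv_bounded_linear)
qed

lemma sum_mass_centered:
  assumes "sum m UNIV \<noteq> 0"
  shows "(\<Sum>a\<in>UNIV. m a *\<^sub>R centered m x $ a) = 0"
  using assms
  by (simp add: scaleR_right_diff_distrib sum_subtractf scaleR_sum_left[symmetric] center_of_mass_def
      del: scaleR_scaleR) simp

lemma wedge_mult_vector: "wedge x y *v u = (y \<bullet> u) *\<^sub>R x - (x \<bullet> u) *\<^sub>R y"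
  by (simp add: wedge_def matrix_vector_mult_def vec_eq_iff inner_vec_def sum_3 algebra_simps)

text \<open>Both sides are values of the bilinear form \<open>\<Sum>\<^sub>a m\<^sub>a Q\<^sub>a \<otimes> V\<^sub>a\<close>, whose skew-symmetric part is half
  the angular momentum.\<close>

lemma angular_momentum_zero_imp_symmetric:
  assumes "angular_momentum m x v = 0"
  shows "(\<Sum>a\<in>UNIV. m a * ((z \<bullet> centered m x $ a) * (u \<bullet> centered m v $ a))) =
         (\<Sum>a\<in>UNIV. m a * ((u \<bullet> centered m x $ a) * (z \<bullet> centered m v $ a)))"
proof -
  have lin: "linear (\<lambda>A::real^3^3. z \<bullet> (A *v u))"
    by (rule linearI) (simp_all add: matrix_vector_mult_add_rdistrib inner_add_right scaleR_matrix_vector_assoc[symmetric])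
  have "0 = z \<bullet> (angular_momentum m x v *v u)"
    by (simp add: assms)
  also have "\<dots> = (\<Sum>a\<in>UNIV. z \<bullet> ((m a *\<^sub>R wedge (centered m x $ a) (centered m v $ a)) *v u))"
    unfolding angular_momentum_def centered_nth by (rule linear_sum[OF lin])
  also have "\<dots> = (\<Sum>a\<in>UNIV. m a * ((z \<bullet> centered m x $ a) * (u \<bullet> centered m v $ a))
      - m a * ((u \<bullet> centered m x $ a) * (z \<bullet> centered m v $ a)))"
    by (intro sum.cong refl)
       (simp only: scaleR_matrix_vector_assoc[symmetric] wedge_mult_vector inner_diff_right inner_scaleR_right
          inner_commute[of _ u] right_diff_distrib mult_ac)
  finally show ?thesis by (simp add: sum_subtractf)
qed

text \<open>Displacing each body in proportion to its signed distance \<open>f a\<close> from a plane through the center of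
  mass changes the separation of the pair \<open>c, d\<close> in the direction \<open>n\<close> in proportion to
  \<open>f c - f d\<close>, which is that separation itself. So the force of every pair does nonpositive work, and since
  distances are at most \<open>r\<close>, this force is at least that of a spring of strength
  \<open>G m\<^sub>c m\<^sub>d / r\<^sup>3\<close>. Lagrange's identity adds up these springs.\<close>

lemma gravity_restores_to_plane:
  assumes m: "\<And>a. m a > 0" and "G > 0"
    and distinct: "\<And>c d. c \<noteq> d \<Longrightarrow> x $ c \<noteq> x $ d"
    and bound: "\<And>c d. c \<noteq> d \<Longrightarrow> dist (x $ c) (x $ d) \<le> r"
    and newton: "\<And>a. \<exists>g. has_partial_gradient (potential G m) a x g \<and> m a *\<^sub>R w $ a = - g"
  shows "(\<Sum>a\<in>UNIV. m a * ((n \<bullet> centered m x $ a) * (n \<bullet> centered m w $ a)))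
    \<le> - (G * sum m UNIV / r ^ 3) * planar_inertia m (centered m x) n"
proof -
  let ?P = "{(c, d). c < (d::4)}"
  define f where "f = (\<lambda>a. n \<bullet> centered m x $ a)"
  have M: "sum m UNIV > 0" using m by (simp add: sum_pos)
  \<comment> \<open>the mean vanishes in the center-of-mass frame, which also removes the acceleration of the center of mass below\<close>
  have mean: "(\<Sum>a\<in>UNIV. m a * f a) = 0"
    using arg_cong[OF sum_mass_centered[of m x], of "inner n"] M by (simp add: f_def inner_sum_right)
  have diff: "n \<bullet> (x $ c - x $ d) = f c - f d" for c d
    by (simp add: f_def inner_diff_right)
  have "(\<Sum>a\<in>UNIV. m a * (f a * (n \<bullet> centered m w $ a))) =
      (\<Sum>a\<in>UNIV. m a * (f a * (n \<bullet> w $ a))) - (\<Sum>a\<in>UNIV. m a * f a) * (n \<bullet> center_of_mass m w)"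
    unfolding sum_distrib_right sum_subtractf[symmetric]
    by (intro sum.cong refl) (simp add: inner_diff_right algebra_simps)
  also have "\<dots> = - (G * (\<Sum>(c, d) \<in> ?P. m c * m d * (f c - f d)\<^sup>2 / dist (x $ c) (x $ d) ^ 3))"
    unfolding mean newton_virtual_work[OF distinct newton, simplified] diff by (simp add: power2_eq_square)
  also have "\<dots> \<le> - (G * (\<Sum>(c, d) \<in> ?P. m c * m d * (f c - f d)\<^sup>2 / r ^ 3))"
  proof -
    have "(\<Sum>(c, d) \<in> ?P. m c * m d * (f c - f d)\<^sup>2 / r ^ 3)
        \<le> (\<Sum>(c, d) \<in> ?P. m c * m d * (f c - f d)\<^sup>2 / dist (x $ c) (x $ d) ^ 3)"
    proof (rule sum_mono, clarify)
      fix c d :: 4 assume "c < d"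
      then have "0 < dist (x $ c) (x $ d)" "dist (x $ c) (x $ d) \<le> r"
        using distinct bound by auto
      moreover from this have "0 < r" by linarith
      ultimately show "m c * m d * (f c - f d)\<^sup>2 / r ^ 3 \<le> m c * m d * (f c - f d)\<^sup>2 / dist (x $ c) (x $ d) ^ 3"
        using m[of c] m[of d] by (intro divide_left_mono power_mono mult_pos_pos zero_less_power) auto
    qed
    then show ?thesis using \<open>G > 0\<close> by simp
  qed
  also have "\<dots> = - (G * ((\<Sum>(c, d) \<in> ?P. m c * m d * (f c - f d)\<^sup>2) / r ^ 3))"
    by (simp add: sum_divide_distrib case_prod_beta)
  also have "\<dots> = - (G * sum m UNIV / r ^ 3) * planar_inertia m (centered m x) n"
    unfolding sum_pairs_weighted_square_diff[OF mean] by (simp add: planar_inertia_def f_def)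
  finally show ?thesis by (simp add: f_def)
qed

lemma planar_inertia_pos:
  assumes m: "\<And>a. m a > 0" and "\<not> coplanar (range (\<lambda>a. x $ a))" "n \<noteq> 0"
  shows "planar_inertia m (centered m x) n > 0"
proof (rule ccontr)
  assume not_pos: "\<not> ?thesis"
  have nonneg: "0 \<le> m a * (n \<bullet> centered m x $ a)\<^sup>2" for a
    using m[of a] by simp
  then have "0 \<le> planar_inertia m (centered m x) n"
    unfolding planar_inertia_def by (rule sum_nonneg)
  with not_pos have "(\<Sum>a\<in>UNIV. m a * (n \<bullet> centered m x $ a)\<^sup>2) = 0"
    unfolding planar_inertia_def by linarith
  then have "m a * (n \<bullet> centered m x $ a)\<^sup>2 = 0" for a
    using nonneg by (simp add: sum_nonneg_eq_0_iff del: centered_nth)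
  then have "n \<bullet> centered m x $ a = 0" for a
    using m[of a] by (metis less_irrefl mult_eq_0_iff power_eq_0_iff)
  then have "n \<bullet> x $ a = n \<bullet> center_of_mass m x" for a
    by (simp add: inner_diff_right)
  then have "coplanar (range (\<lambda>a. x $ a))"
    by (intro coplanar_if_subset_hyperplane[OF \<open>n \<noteq> 0\<close>, where s = "n \<bullet> center_of_mass m x"]) auto
  with assms(2) show False ..
qed

text \<open>The affine function taking the values \<open>n \<bullet> v $ a\<close> at the points \<open>x $ a\<close> has \<open>b\<close> as its linear part;
  its constant part disappears in the center-of-mass frame, where both sides have weighted mean zero.\<close>

lemma centered_interpolation:
  assumes m: "\<And>a. m a > 0" and "\<not> coplanar (range (\<lambda>a. x $ a))"
  obtains b where "\<And>a. b \<bullet> centered m x $ a = n \<bullet> centered m v $ a"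
proof -
  have M: "sum m UNIV > 0" using m by (simp add: sum_pos)
  obtain b s where bs: "\<And>a. b \<bullet> x $ a + s = n \<bullet> v $ a"
    using affine_interpolation[OF assms(2), of "\<lambda>a. n \<bullet> v $ a"] by metis
  define e where "e = n \<bullet> center_of_mass m v - b \<bullet> center_of_mass m x - s"
  have e: "b \<bullet> centered m x $ a - n \<bullet> centered m v $ a = e" for a
    using bs[of a] by (simp add: e_def inner_diff_right)
  have "sum m UNIV * e = (\<Sum>a\<in>UNIV. m a * (b \<bullet> centered m x $ a - n \<bullet> centered m v $ a))"
    unfolding e by (simp add: sum_distrib_right)
  also have "\<dots> = b \<bullet> (\<Sum>a\<in>UNIV. m a *\<^sub>R centered m x $ a) - n \<bullet> (\<Sum>a\<in>UNIV. m a *\<^sub>R centered m v $ a)"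
    by (simp add: inner_sum_right right_diff_distrib sum_subtractf del: centered_nth)
  also have "\<dots> = 0"
    using sum_mass_centered[of m] M by (simp del: centered_nth)
  finally have "e = 0" using M by simp
  then show ?thesis using e that[of b] by simp
qed

section \<open>Comparison with a harmonic oscillator\<close>

text \<open>Sturm comparison at a touching point: a solution of \<open>\<psi>'' = - \<omega> \<psi>\<close> cannot support from below,
  with equality at an interior time, the square root of the smallest value of \<open>C\<close> times the planar
  inertia on unit vectors when the force is restoring at a rate \<open>\<kappa> > \<omega>\<close>;
  here \<open>\<omega>\<close> is the square of a frequency.

  Squares are compared, and the quotient by \<open>|n(t)|\<^sup>2\<close> is cleared, so that the function \<open>h\<close> with
  a minimum at \<open>t0\<close> is built from products only. Its first-order condition determines \<open>\<psi>1 t0\<close>, and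
  its second derivative is then at most
  \<open>(\<psi> t0)\<^sup>2 (2 (\<omega> - \<kappa>) + 6 ((n0 \<bullet> b)\<^sup>2 - b \<bullet> b)) < 0\<close> by the Cauchy-Schwarz inequality.\<close>

lemma no_support_of_planar_inertia:
  fixes y y1 :: "real \<Rightarrow> 'a::real_inner ^ 'n::finite" and \<psi> \<psi>1 :: "real \<Rightarrow> real"
  assumes "\<delta> > 0"
    and y: "\<And>t. \<bar>t - t0\<bar> < \<delta> \<Longrightarrow> (y has_vector_derivative y1 t) (at t)"
    and y1: "(y1 has_vector_derivative y2) (at t0)"
    and \<psi>: "\<And>t. (\<psi> has_real_derivative \<psi>1 t) (at t)"
    and \<psi>1: "(\<psi>1 has_real_derivative - \<omega> * \<psi> t0) (at t0)"
    and b: "\<And>a. b \<bullet> y t0 $ a = n0 \<bullet> y1 t0 $ a"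
    and symm: "(\<Sum>a\<in>UNIV. m a * ((n0 \<bullet> y t0 $ a) * (b \<bullet> y1 t0 $ a))) =
              (\<Sum>a\<in>UNIV. m a * ((b \<bullet> y t0 $ a) * (n0 \<bullet> y1 t0 $ a)))"
    and acc: "(\<Sum>a\<in>UNIV. m a * ((n0 \<bullet> y t0 $ a) * (n0 \<bullet> y2 $ a))) \<le> - \<kappa> * planar_inertia m (y t0) n0"
    and below: "\<And>t n. \<bar>t - t0\<bar> < \<delta> \<Longrightarrow> (\<psi> t)\<^sup>2 * (n \<bullet> n) \<le> C * planar_inertia m (y t) n"
    and touch: "(\<psi> t0)\<^sup>2 = C * planar_inertia m (y t0) n0"
    and "n0 \<bullet> n0 = 1" "\<psi> t0 \<noteq> 0" "C > 0" "\<omega> < \<kappa>"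
  shows False
proof -
  define \<nu> where "\<nu> = (\<lambda>t. n0 - (t - t0) *\<^sub>R b)"
  define F where "F = (\<lambda>t a. \<nu> t \<bullet> y t $ a)"
  define F1 where "F1 = (\<lambda>t a. \<nu> t \<bullet> y1 t $ a - b \<bullet> y t $ a)"
  define F2 where "F2 = (\<lambda>a. n0 \<bullet> y2 $ a - 2 * (b \<bullet> y1 t0 $ a))"
  define h where "h = (\<lambda>t. C * (\<Sum>a\<in>UNIV. m a * (F t a)\<^sup>2) - (\<psi> t)\<^sup>2 * (\<nu> t \<bullet> \<nu> t))"
  define h1 where "h1 = (\<lambda>t. C * (\<Sum>a\<in>UNIV. m a * (2 * F t a * F1 t a))
    - (2 * \<psi> t * \<psi>1 t * (\<nu> t \<bullet> \<nu> t) - 2 * (\<psi> t)\<^sup>2 * (\<nu> t \<bullet> b)))"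
  define k where "k = n0 \<bullet> b"
  define h2 where "h2 = C * (\<Sum>a\<in>UNIV. m a * (2 * (F1 t0 a)\<^sup>2 + 2 * F t0 a * F2 a))
    - (2 * ((\<psi>1 t0)\<^sup>2 - \<omega> * (\<psi> t0)\<^sup>2) - 8 * \<psi> t0 * \<psi>1 t0 * k + 2 * (\<psi> t0)\<^sup>2 * (b \<bullet> b))"
  have \<nu>: "(\<nu> has_vector_derivative - b) (at t)" for t
    unfolding \<nu>_def by (auto intro!: derivative_eq_intros)
  have \<nu>0: "\<nu> t0 = n0" by (simp add: \<nu>_def)
  have component: "((\<lambda>t. z t $ a) has_vector_derivative z' $ a) F"
    if "(z has_vector_derivative z') F" for z :: "real \<Rightarrow> 'a^'n" and z' a F
    using bounded_linear.has_vector_derivative[OF bounded_linear_vec_nth that] .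
  have inner: "((\<lambda>t. c t \<bullet> z t) has_real_derivative c t \<bullet> z' + c' \<bullet> z t) (at t)"
    if "(c has_vector_derivative c') (at t)" "(z has_vector_derivative z') (at t)"
    for c z :: "real \<Rightarrow> 'a" and c' z' t
    using bounded_bilinear.has_vector_derivative[OF bounded_bilinear_inner that]
    by (simp add: has_real_derivative_iff_has_vector_derivative)
  have F: "((\<lambda>t. F t a) has_real_derivative F1 t a) (at t)" if "\<bar>t - t0\<bar> < \<delta>" for t a
    using inner[OF \<nu> component[OF y[OF that]]] by (simp add: F_def F1_def)
  have y0: "(y has_vector_derivative y1 t0) (at t0)"
    using y \<open>\<delta> > 0\<close> by simp
  have F1: "((\<lambda>t. F1 t a) has_real_derivative F2 a) (at t0)" for a
    unfolding F1_def F2_def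
    by (rule DERIV_cong[OF DERIV_diff[OF inner[OF \<nu> component[OF y1]]
          inner[OF has_vector_derivative_const component[OF y0]]]])
       (simp add: \<nu>0)
  have \<nu>\<nu>: "((\<lambda>t. \<nu> t \<bullet> \<nu> t) has_real_derivative - 2 * (\<nu> t \<bullet> b)) (at t)" for t
    using inner[OF \<nu> \<nu>, of t] by (simp add: inner_commute)
  have \<nu>b: "((\<lambda>t. \<nu> t \<bullet> b) has_real_derivative - (b \<bullet> b)) (at t)" for t
    using inner[OF \<nu>[of t] has_vector_derivative_const[of b]] by simp
  have h: "(h has_real_derivative h1 t) (at t)" if "\<bar>t - t0\<bar> < \<delta>" for t
    unfolding h_def h1_def
    by (rule derivative_eq_intros F[OF that] \<psi> \<nu>\<nu> refl)+ (simp add: algebra_simps)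
  have h1: "(h1 has_real_derivative h2) (at t0)"
    unfolding h1_def h2_def
    apply (rule derivative_eq_intros F F1 \<psi> \<psi>1 \<nu>\<nu> \<nu>b refl | simp add: \<open>\<delta> > 0\<close>)+
    using \<open>n0 \<bullet> n0 = 1\<close> by (simp add: \<nu>0 k_def algebra_simps power2_eq_square)
  \<comment> \<open>the defining property of \<open>b\<close>: the signed distances are stationary at \<open>t0\<close>\<close>
  have F0: "F t0 a = n0 \<bullet> y t0 $ a" and F10: "F1 t0 a = 0" for a
    by (simp_all add: F_def F1_def \<nu>0 b)
  have hmin: "h t0 \<le> h t" if "\<bar>t - t0\<bar> < \<delta>" for t
    using below[OF that, of "\<nu> t"] touch \<open>n0 \<bullet> n0 = 1\<close>
    by (simp add: h_def planar_inertia_def F_def \<nu>0)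
  note second = second_derivative_nonneg_at_local_min[OF \<open>\<delta> > 0\<close> h h1 hmin]
  have "\<psi> t0 * (\<psi>1 t0 - k * \<psi> t0) = 0"
    using second(1) \<open>n0 \<bullet> n0 = 1\<close> by (auto simp: h1_def F10 \<nu>0 k_def algebra_simps power2_eq_square)
  then have \<psi>10: "\<psi>1 t0 = k * \<psi> t0"
    using \<open>\<psi> t0 \<noteq> 0\<close> by simp
  have distrib: "C * (2 * A - 4 * P) = 2 * (C * A) - 4 * (C * P)" for A P
    by (simp add: algebra_simps)
  have "(\<Sum>a\<in>UNIV. m a * (2 * (F1 t0 a)\<^sup>2 + 2 * F t0 a * F2 a)) =
      2 * (\<Sum>a\<in>UNIV. m a * ((n0 \<bullet> y t0 $ a) * (n0 \<bullet> y2 $ a)))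
      - 4 * (\<Sum>a\<in>UNIV. m a * ((n0 \<bullet> y t0 $ a) * (b \<bullet> y1 t0 $ a)))"
    unfolding sum_distrib_left sum_subtractf[symmetric] F0 F10 F2_def
    by (intro sum.cong refl) (simp add: algebra_simps)
  \<comment> \<open>by symmetry both factors of each term become \<open>b \<bullet> y t0 $ a\<close>\<close>
  also have "(\<Sum>a\<in>UNIV. m a * ((n0 \<bullet> y t0 $ a) * (b \<bullet> y1 t0 $ a))) = planar_inertia m (y t0) b"
    unfolding symm by (simp add: planar_inertia_def b power2_eq_square)
  finally have sum_eq: "C * (\<Sum>a\<in>UNIV. m a * (2 * (F1 t0 a)\<^sup>2 + 2 * F t0 a * F2 a)) =
      2 * (C * (\<Sum>a\<in>UNIV. m a * ((n0 \<bullet> y t0 $ a) * (n0 \<bullet> y2 $ a)))) - 4 * (C * planar_inertia m (y t0) b)"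
    using distrib by simp
  have "C * (\<Sum>a\<in>UNIV. m a * ((n0 \<bullet> y t0 $ a) * (n0 \<bullet> y2 $ a))) \<le> - \<kappa> * (\<psi> t0)\<^sup>2"
    using mult_left_mono[OF acc, of C] \<open>C > 0\<close> by (simp add: touch mult_ac)
  moreover have "(\<psi> t0)\<^sup>2 * (b \<bullet> b) \<le> C * planar_inertia m (y t0) b"
    using below[of t0 b] \<open>\<delta> > 0\<close> by simp
  ultimately have "h2 \<le> 2 * (- \<kappa> * (\<psi> t0)\<^sup>2) - 4 * ((\<psi> t0)\<^sup>2 * (b \<bullet> b))
    - (2 * ((\<psi>1 t0)\<^sup>2 - \<omega> * (\<psi> t0)\<^sup>2) - 8 * \<psi> t0 * \<psi>1 t0 * k + 2 * (\<psi> t0)\<^sup>2 * (b \<bullet> b))"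
    unfolding h2_def sum_eq by linarith
  also have "\<dots> = (\<psi> t0)\<^sup>2 * (2 * (\<omega> - \<kappa>) + 6 * (k\<^sup>2 - b \<bullet> b))"
    unfolding \<psi>10 by (simp add: algebra_simps power2_eq_square)
  also have "\<dots> < 0"
  proof -
    have "k\<^sup>2 \<le> b \<bullet> b"
      using Cauchy_Schwarz_ineq[of n0 b] \<open>n0 \<bullet> n0 = 1\<close> by (simp add: k_def)
    then show ?thesis
      using \<open>\<omega> < \<kappa>\<close> \<open>\<psi> t0 \<noteq> 0\<close> by (intro mult_pos_neg) auto
  qed
  finally show False using second(2) by simp
qed

section \<open>Coplanar times\<close>

text \<open>Without coplanar times in the interval, \<open>\<psi>\<^sup>2 / \<Theta>\<close> is continuous on the compact set of pairs of a time
  in the interval and a unit vector. A point where it is maximal is a touching point, and as \<open>\<psi>\<close>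
  vanishes at both ends of the interval, the touching time is interior.\<close>

lemma coplanar_time_in_long_interval:
  assumes "G > 0" and m: "\<And>a. m a > 0"
    and sol: "newton_solution G m I q v"
    and ang: "\<And>t. t \<in> I \<Longrightarrow> angular_momentum m (q t) (v t) = 0"
    and bound: "\<And>t a b. t \<in> I \<Longrightarrow> a \<noteq> b \<Longrightarrow> dist (q t $ a) (q t $ b) \<le> r"
    and "\<omega> > 0" "\<omega>\<^sup>2 < G * sum m UNIV / r ^ 3"
    and sub: "{s..s + pi / \<omega>} \<subseteq> I"
  shows "\<exists>t\<in>{s..s + pi / \<omega>}. coplanar (range (\<lambda>a. q t $ a))"
proof (rule ccontr)
  let ?J = "{s..s + pi / \<omega>}"
  assume "\<not> ?thesis"
  then have noncoplanar: "\<not> coplanar (range (\<lambda>a. q t $ a))" if "t \<in> ?J" for t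
    using that by blast
  define y where "y = (\<lambda>t. centered m (q t))"
  define y1 where "y1 = (\<lambda>t. centered m (v t))"
  define \<psi> where "\<psi> = (\<lambda>t. sin (\<omega> * (t - s)))"
  define \<Theta> where "\<Theta> = (\<lambda>t n. planar_inertia m (y t) n)"
  have pos: "\<Theta> t n > 0" if "t \<in> ?J" "n \<noteq> 0" for t n
    unfolding \<Theta>_def y_def by (rule planar_inertia_pos[where m = m, OF m noncoplanar[OF that(1)] that(2)])
  have "(q has_vector_derivative v t) (at t within I)" if "t \<in> I" for t
    using sol that by (simp add: newton_solution_def)
  then have y_within: "(y has_vector_derivative y1 t) (at t within I)" if "t \<in> I" for t
    unfolding y_def y1_def
    by (intro bounded_linear.has_vector_derivative[OF bounded_linear_centered]) (use that in simp)
  have cont_y: "continuous_on ?J y"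
  proof (rule continuous_on_subset[OF _ sub])
    show "continuous_on I y"
      unfolding continuous_on_eq_continuous_within
      by (intro ballI has_vector_derivative_continuous[OF y_within])
  qed
  let ?K = "?J \<times> sphere (0::real^3) 1"
  have compact_K: "compact ?K" by (intro compact_Times compact_Icc compact_sphere)
  \<comment> \<open>the midpoint, where \<open>\<psi>\<close> equals 1, also shows that the maximum is positive\<close>
  have mid_K: "(s + pi / (2 * \<omega>), axis 1 1) \<in> ?K"
    using \<open>\<omega> > 0\<close> by (auto simp: norm_axis_1 divide_simps)
  have cont_ratio: "continuous_on ?K (\<lambda>p. (\<psi> (fst p))\<^sup>2 / \<Theta> (fst p) (snd p))"
  proof -
    have "continuous_on ?K (\<lambda>p. y (fst p))"
      by (rule continuous_on_compose2[OF cont_y]) (auto intro: continuous_intros)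
    moreover have "\<Theta> (fst p) (snd p) \<noteq> 0" if "p \<in> ?K" for p
    proof -
      have "fst p \<in> ?J" "snd p \<noteq> 0" using that by (auto simp: mem_Times_iff)
      then have "0 < \<Theta> (fst p) (snd p)" by (rule pos)
      then show ?thesis by simp
    qed
    ultimately show ?thesis
      unfolding \<psi>_def \<Theta>_def planar_inertia_def by (intro continuous_intros) auto
  qed
  have "?K \<noteq> {}" using mid_K by blast
  from continuous_attains_sup[OF compact_K this cont_ratio]
  obtain p where p: "p \<in> ?K"
    and p_max: "\<forall>p'\<in>?K. (\<psi> (fst p'))\<^sup>2 / \<Theta> (fst p') (snd p') \<le> (\<psi> (fst p))\<^sup>2 / \<Theta> (fst p) (snd p)"
    by (rule bexE)
  obtain t0 n0 where p_eq: "p = (t0, n0)" by (cases p)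
  have K0: "(t0, n0) \<in> ?K" using p unfolding p_eq .
  have max: "(\<psi> t)\<^sup>2 / \<Theta> t n \<le> (\<psi> t0)\<^sup>2 / \<Theta> t0 n0" if "(t, n) \<in> ?K" for t n
    using bspec[OF p_max that] by (simp add: p_eq)
  define C where "C = (\<psi> t0)\<^sup>2 / \<Theta> t0 n0"
  have t0: "t0 \<in> ?J" and n0: "norm n0 = 1" using K0 by auto
  have \<Theta>0: "\<Theta> t0 n0 > 0" using n0 by (intro pos[OF t0]) auto
  have "C > 0"
  proof -
    let ?t = "s + pi / (2 * \<omega>)" and ?n = "axis 1 1 :: real^3"
    have "\<psi> ?t = 1"
      using \<open>\<omega> > 0\<close> by (simp add: \<psi>_def)
    moreover have "\<Theta> ?t ?n > 0"
      using mid_K by (intro pos) auto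
    ultimately have "0 < (\<psi> ?t)\<^sup>2 / \<Theta> ?t ?n" by simp
    also have "\<dots> \<le> C" unfolding C_def by (rule max[OF mid_K])
    finally show ?thesis .
  qed
  then have \<psi>0: "\<psi> t0 \<noteq> 0" by (auto simp: C_def)
  have "\<psi> s = 0" "\<psi> (s + pi / \<omega>) = 0"
    using \<open>\<omega> > 0\<close> by (simp_all add: \<psi>_def)
  with \<psi>0 have "t0 \<noteq> s" "t0 \<noteq> s + pi / \<omega>" by metis+
  then have open_J: "s < t0" "t0 < s + pi / \<omega>" using t0 by auto
  define \<delta> where "\<delta> = min (t0 - s) (s + pi / \<omega> - t0)"
  have "\<delta> > 0" using open_J by (simp add: \<delta>_def)
  have near: "t \<in> {s<..<s + pi / \<omega>}" if "\<bar>t - t0\<bar> < \<delta>" for t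
    using that by (auto simp: \<delta>_def)
  have at: "(f has_vector_derivative f') (at t)"
    if "(f has_vector_derivative f') (at t within I)" "\<bar>t - t0\<bar> < \<delta>" for f :: "real \<Rightarrow> real^3^4" and f' t
  proof -
    have "{s<..<s + pi / \<omega>} \<subseteq> I"
      by (rule order_trans[OF _ sub]) (rule subsetI, simp)
    then have "(f has_vector_derivative f') (at t within {s<..<s + pi / \<omega>})"
      by (rule has_vector_derivative_within_subset[OF that(1)])
    then show ?thesis
      by (simp only: at_within_open[OF near[OF that(2)] open_greaterThanLessThan])
  qed
  have "t0 \<in> I" using t0 sub by blast
  note at_t0 = bspec[OF sol[unfolded newton_solution_def] \<open>t0 \<in> I\<close>]
  obtain w where w: "(v has_vector_derivative w) (at t0 within I)"
    and newton: "\<forall>a. \<exists>g. has_partial_gradient (potential G m) a (q t0) g \<and> m a *\<^sub>R w $ a = - g"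
    using at_t0 by (elim conjE exE) (rule that)
  have distinct: "q t0 $ a \<noteq> q t0 $ b" if "a \<noteq> b" for a b
    using conjunct1[OF at_t0] that unfolding zero_less_dist_iff by blast
  obtain b where b: "\<And>a. b \<bullet> y t0 $ a = n0 \<bullet> y1 t0 $ a"
    unfolding y_def y1_def
    using centered_interpolation[where m = m and n = n0 and v = "v t0", OF m noncoplanar[OF t0]] by blast
  show False
  proof (rule no_support_of_planar_inertia[OF \<open>\<delta> > 0\<close>, where y = y and \<psi> = \<psi> and m = m and C = C])
    show "(y has_vector_derivative y1 t) (at t)" if "\<bar>t - t0\<bar> < \<delta>" for t
    proof -
      have "t \<in> I" using near[OF that] by (intro subsetD[OF sub]) simp
      then show ?thesis by (intro at y_within that)
    qed
    show "(y1 has_vector_derivative centered m w) (at t0)"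
      unfolding y1_def
      by (intro at bounded_linear.has_vector_derivative[OF bounded_linear_centered w]) (use \<open>\<delta> > 0\<close> in simp)
    show "(\<psi> has_real_derivative \<omega> * cos (\<omega> * (t - s))) (at t)" for t
      unfolding \<psi>_def by (auto intro!: derivative_eq_intros)
    show "((\<lambda>t. \<omega> * cos (\<omega> * (t - s))) has_real_derivative - \<omega>\<^sup>2 * \<psi> t0) (at t0)"
      unfolding \<psi>_def by (auto intro!: derivative_eq_intros simp: power2_eq_square)
    show "b \<bullet> y t0 $ a = n0 \<bullet> y1 t0 $ a" for a by (rule b)
    show "(\<Sum>a\<in>UNIV. m a * ((n0 \<bullet> y t0 $ a) * (b \<bullet> y1 t0 $ a))) =
        (\<Sum>a\<in>UNIV. m a * ((b \<bullet> y t0 $ a) * (n0 \<bullet> y1 t0 $ a)))"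
      unfolding y_def y1_def
      by (rule angular_momentum_zero_imp_symmetric) (use ang sub t0 in blast)
    show "(\<Sum>a\<in>UNIV. m a * ((n0 \<bullet> y t0 $ a) * (n0 \<bullet> centered m w $ a)))
        \<le> - (G * sum m UNIV / r ^ 3) * planar_inertia m (y t0) n0"
      unfolding y_def using bound[of t0] sub t0
      by (intro gravity_restores_to_plane[where m = m, OF m \<open>G > 0\<close> distinct _ spec[OF newton]]) auto
    show "(\<psi> t)\<^sup>2 * (n \<bullet> n) \<le> C * planar_inertia m (y t) n" if "\<bar>t - t0\<bar> < \<delta>" for t n
    proof (cases "n = 0")
      case True
      then show ?thesis by (simp add: planar_inertia_def)
    next
      case False
      have t: "t \<in> ?J" using near[OF that] by auto
      have "planar_inertia m (y t) (n /\<^sub>R norm n) = planar_inertia m (y t) n / (norm n)\<^sup>2"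
        by (simp add: planar_inertia_def sum_distrib_left power_mult_distrib divide_inverse power_inverse mult_ac)
      moreover have "(\<psi> t)\<^sup>2 / \<Theta> t (n /\<^sub>R norm n) \<le> C"
        unfolding C_def using t False by (intro max) auto
      ultimately have "(\<psi> t)\<^sup>2 * (norm n)\<^sup>2 / \<Theta> t n \<le> C"
        by (simp add: \<Theta>_def)
      then show ?thesis
        using pos[OF t False] by (simp add: \<Theta>_def divide_le_eq dot_square_norm)
    qed
    show "(\<psi> t0)\<^sup>2 = C * planar_inertia m (y t0) n0"
      using \<Theta>0 by (simp add: C_def \<Theta>_def)
    show "n0 \<bullet> n0 = 1" using n0 by (simp add: dot_square_norm)
  qed (fact \<psi>0 \<open>C > 0\<close> assms)+
qed

lemma unbounded_if_infinite_length:
  fixes I :: "real set"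
  assumes "emeasure lborel I = \<infinity>"
  obtains t where "t \<in> I" "\<bar>t\<bar> > B"
proof -
  have "\<not> I \<subseteq> {- B..B}"
  proof
    assume "I \<subseteq> {- B..B}"
    then have "emeasure lborel I \<le> emeasure lborel {- B..B}"
      by (rule emeasure_mono) simp
    with assms show False
      by (simp add: emeasure_lborel_Icc_eq top_unique split: if_splits)
  qed
  then show ?thesis using that by force
qed

theorem theorem1p1:
  fixes G :: real and m :: "4 \<Rightarrow> real"
    and I :: "real set" and q v :: "real \<Rightarrow> real^3^4"
  assumes "G > 0"
    and "\<And>a. m a > 0"
    and "is_interval I" and "emeasure lborel I = \<infinity>"
    and "newton_solution G m I q v"
    and "\<And>t. t \<in> I \<Longrightarrow> angular_momentum m (q t) (v t) = 0"
    and "bounded_solution I q"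
  shows "infinite {t \<in> I. coplanar (range (\<lambda>a. q t $ a))}"
proof
  let ?T = "{t \<in> I. coplanar (range (\<lambda>a. q t $ a))}"
  assume "finite ?T"
  then obtain B where "B > 0" and B: "\<And>t. t \<in> ?T \<Longrightarrow> \<bar>t\<bar> \<le> B"
    using finite_imp_bounded[of ?T] bounded_pos[of ?T] by auto
  obtain c where c: "\<forall>t\<in>I. \<forall>a b. a \<noteq> b \<longrightarrow> dist (q t $ a) (q t $ b) \<le> c"
    using assms(7) unfolding bounded_solution_def ..
  \<comment> \<open>a positive bound, because its cube is a denominator\<close>
  define r where "r = max c 1"
  have r: "r > 0" "\<And>t a b. t \<in> I \<Longrightarrow> a \<noteq> b \<Longrightarrow> dist (q t $ a) (q t $ b) \<le> r"
    using c by (auto simp: r_def le_max_iff_disj)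
  \<comment> \<open>any \<open>\<omega>\<close> strictly between 0 and the square root of \<open>\<kappa>\<close> would do\<close>
  define \<omega> where "\<omega> = sqrt (G * sum m UNIV / r ^ 3 / 2)"
  have \<kappa>: "G * sum m UNIV / r ^ 3 > 0"
    using assms(1,2) r(1) by (simp add: sum_pos)
  then have \<omega>: "\<omega> > 0" "\<omega>\<^sup>2 < G * sum m UNIV / r ^ 3"
    by (simp_all add: \<omega>_def)
  define l where "l = pi / \<omega>"
  have "l > 0" using \<omega>(1) by (simp add: l_def)
  obtain t1 where t1: "t1 \<in> I"
    using unbounded_if_infinite_length[OF assms(4)] by blast
  obtain t2 where t2: "t2 \<in> I" "\<bar>t2\<bar> > B + \<bar>t1\<bar> + l"
    using unbounded_if_infinite_length[OF assms(4)] by blast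
  \<comment> \<open>the interval of length \<open>l\<close> ending or starting at \<open>t2\<close> on the side of \<open>t1\<close> stays beyond \<open>B\<close> in absolute value\<close>
  define s where "s = (if t2 > 0 then t2 - l else t2)"
  have between: "t \<in> I" if "min t1 t2 \<le> t" "t \<le> max t1 t2" for t
    using mem_is_interval_1_I[OF assms(3) t1 t2(1), of t] mem_is_interval_1_I[OF assms(3) t2(1) t1, of t] that
    by (auto simp: min_def max_def split: if_splits)
  have s: "t \<in> I \<and> \<bar>t\<bar> > B" if "t \<in> {s..s + l}" for t
    using that t2(2) \<open>l > 0\<close> \<open>B > 0\<close> by (intro conjI between) (auto simp: s_def split: if_splits)
  obtain t where "t \<in> {s..s + l}" "coplanar (range (\<lambda>a. q t $ a))"
    using coplanar_time_in_long_interval[OF assms(1,2,5,6) r(2) \<omega>, of s] s unfolding l_def by blast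
  then show False using s[of t] B[of t] by auto
qed

end
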